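(* There exist a constant $C = C(d) > 0$ and a family of $(d-1)$-dimensional flag spheres $\mathcal K_n$ satisfying $f_0(\mathcal K_n) \to \infty$ as $n \to \infty$, and $$\alpha(G(\mathcal K_n)) \;\geq\; f_0(\mathcal K_n) - \frac{C f_0(\mathcal K_n)}{\left(\log f_0(\mathcal K_n)\right)^{\lfloor d/2 \rfloor - 1}}$$ for all sufficiently large $n$. When $d \geq 4$, taking $n \to \infty$ gives $$\lim_{n \to \infty} \frac{\alpha(G(\mathcal K_n))}{f_0(\mathcal K_n)} = 1.$$
   Context: A simplicial complex $\mathcal K$ on a vertex set $V$ is a collection of subsets of $V$ (called faces) with $\{v\}\in\mathcal K$ for all $v\in V$ and closed under taking subsets. The dimension of a face $F$ is $|F|-1$, and $f_0(\mathcal K)$ is the number of vertices ($0$-dimensional faces) of $\mathcal K$. The graph $G(\mathcal K)$ is the $1$-skeleton of $\mathcal K$: its vertices are the vertices of $\mathcal K$ and its edges are the $1$-dimensional faces. $\mathcal K$ is flag if every minimal non-face has exactly two vertices; equivalently, every clique (set of pairwise adjacent vertices) of $G(\mathcal K)$ is a face of $\mathcal K$. A $(d-1)$-dimensional flag sphere is a flag simplicial complex whose geometric realization is homeomorphic to the sphere $\mathbb S^{d-1}$. The constant $C$ depends only on $d$. The independence number $\alpha(G)$ of a graph $G$ is the size of its largest independent set, i.e. the maximum size of a set of pairwise non-adjacent vertices. $\log$ is the natural logarithm. *)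

theory Defs
  imports "HOL-Analysis.Analysis"
begin

text \<open>
  Abstract simplicial complexes are sets of faces. The vertex set is recovered from the faces,
  see \<open>simplicial_complex_on_vertices\<close> below. (The constant \<open>simplicial_complex\<close> of
  HOL-Analysis is about geometric complexes in a Euclidean space.) All complexes are finite.
\<close>

definition simplicial_complex_on :: "'a set \<Rightarrow> 'a set set \<Rightarrow> bool" where
  "simplicial_complex_on V K \<longleftrightarrow>
     finite V \<and> K \<subseteq> Pow V \<and> (\<forall>v\<in>V. {v} \<in> K) \<and> (\<forall>F\<in>K. \<forall>G. G \<subseteq> F \<longrightarrow> G \<in> K)"

definition complex_vertices :: "'a set set \<Rightarrow> 'a set" where
  "complex_vertices K = {v. {v} \<in> K}"

lemma simplicial_complex_on_vertices:
  "simplicial_complex_on V K \<Longrightarrow> complex_vertices K = V"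
  by (auto simp: simplicial_complex_on_def complex_vertices_def)

definition face_dim :: "'a set \<Rightarrow> int" where
  "face_dim F = int (card F) - 1"

definition f0 :: "'a set set \<Rightarrow> nat" where
  "f0 K = card {F \<in> K. face_dim F = 0}"

definition minimal_nonface :: "'a set set \<Rightarrow> 'a set \<Rightarrow> bool" where
  "minimal_nonface K F \<longleftrightarrow> F \<subseteq> complex_vertices K \<and> F \<notin> K \<and> (\<forall>G. G \<subset> F \<longrightarrow> G \<in> K)"

definition flag_complex :: "'a set set \<Rightarrow> bool" where
  "flag_complex K \<longleftrightarrow>
     simplicial_complex_on (complex_vertices K) K \<and> (\<forall>F. minimal_nonface K F \<longrightarrow> card F = 2)"

text \<open>
  Points of the geometric realization are given by their barycentric coordinates, extended by
  zero off the vertex set. As the complexes are finite, the topology of the realization is the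
  one induced from the product topology.
\<close>

definition geometric_realization :: "'a set set \<Rightarrow> ('a \<Rightarrow> real) topology" where
  "geometric_realization K =
     subtopology (powertop_real UNIV)
       {x. (\<forall>v. 0 \<le> x v) \<and> {v. x v \<noteq> 0} \<in> K \<and> (\<Sum>v\<in>complex_vertices K. x v) = 1}"

definition flag_sphere :: "nat \<Rightarrow> 'a set set \<Rightarrow> bool" where
  "flag_sphere m K \<longleftrightarrow>
     flag_complex K \<and> geometric_realization K homeomorphic_space nsphere m"

text \<open>A simple graph is a pair of a vertex set and a set of two-element edges.\<close>

type_synonym 'a graph = "'a set \<times> 'a set set"

definition graph_of :: "'a set set \<Rightarrow> 'a graph" where
  "graph_of K = (complex_vertices K, {F \<in> K. face_dim F = 1})"

definition independent_set :: "'a graph \<Rightarrow> 'a set \<Rightarrow> bool" where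
  "independent_set G S \<longleftrightarrow>
     S \<subseteq> fst G \<and> (\<forall>u\<in>S. \<forall>v\<in>S. u \<noteq> v \<longrightarrow> {u, v} \<notin> snd G)"

definition independence_number :: "'a graph \<Rightarrow> nat" where
  "independence_number G = Max {card S | S. independent_set G S}"

end

theory Submission
  imports Defs
begin

text \<open>
  Subdividing an edge \<open>ab\<close> of a flag sphere by a new vertex gives a flag sphere again. In the join of
  two cycles \<open>C\<^sub>2\<^sub>p\<close>, a 3-sphere, the \<open>p\<^sup>2\<close> edges joining an odd position of the first cycle to an odd
  position of the second one pairwise do not lie in a common face, so their \<open>p\<^sup>2\<close> midpoints are
  independent, whereas only \<open>4 p\<close> vertices existed before. Suspending \<open>d - 4\<close> times gives the
  dimension \<open>d - 1\<close> at the cost of \<open>2 (d - 4)\<close> vertices. Hence all but \<open>O(sqrt f0)\<close> vertices are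
  independent, which beats every power of the logarithm.

  To recognise spheres, vertices are mapped to vectors such that the cones over the faces form a
  complete fan; the realization is then projected radially to the sphere. Complete fans are closed
  under joins, and under edge subdivision with \<open>\<phi> m = \<phi> a + \<phi> b\<close>.
\<close>

section \<open>Powers of the logarithm against the square root\<close>

lemma ln_power_le_sqrt: "\<forall>\<^sub>F x::real in at_top. ln x ^ m \<le> sqrt x"
proof -
  \<comment> \<open>With \<open>y = ln x / 2\<close> one has \<open>sqrt x = exp y\<close>, so the
    claim follows from \<open>y ^ m / exp y\<close> tending to 0. The threshold
    \<open>1 / 2 ^ m\<close> below absorbs the factor that halving the logarithm introduces.\<close>
  have "filterlim (\<lambda>x::real. ln x / 2) at_top at_top"
    by (rule filterlim_at_top_mult_tendsto_pos[of "\<lambda>_. 1 / 2" "1 / 2" _ ln, simplified])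
      (auto intro: ln_at_top)
  then have "((\<lambda>x::real. (ln x / 2) ^ m / exp (ln x / 2)) \<longlongrightarrow> 0) at_top"
    by (rule filterlim_compose[OF tendsto_power_div_exp_0])
  then have "\<forall>\<^sub>F x::real in at_top. (ln x / 2) ^ m / exp (ln x / 2) < 1 / 2 ^ m"
    by (rule order_tendstoD) simp
  with eventually_gt_at_top[of 0] show ?thesis
  proof eventually_elim
    case (elim x)
    have "sqrt x = exp (ln (sqrt x))"
      using elim(1) by simp
    also have "ln (sqrt x) = ln x / 2"
      using elim(1) by (simp add: ln_sqrt)
    finally have "exp (ln x / 2) = sqrt x" ..
    with elim show ?case
      by (simp add: power_divide field_simps)
  qed
qed

section \<open>Clique complexes and complete fans\<close>

text \<open>A flag complex is determined by its graph, so the spheres are built from a vertex set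
  and an adjacency relation.\<close>

definition clique_complex :: "'a set \<Rightarrow> ('a \<Rightarrow> 'a \<Rightarrow> bool) \<Rightarrow> 'a set set" where
  "clique_complex V adj = {F. F \<subseteq> V \<and> (\<forall>u\<in>F. \<forall>v\<in>F. u \<noteq> v \<longrightarrow> adj u v)}"

lemma complex_vertices_clique_complex [simp]: "complex_vertices (clique_complex V adj) = V"
  by (auto simp: complex_vertices_def clique_complex_def)

text \<open>Every non-clique contains a non-adjacent pair, which is itself a nonface; minimality
  leaves nothing besides this pair.\<close>

lemma flag_complex_clique_complex:
  assumes "finite V"
  shows "flag_complex (clique_complex V adj)"
proof -
  have "card F = 2" if "minimal_nonface (clique_complex V adj) F" for F
  proof -
    have F: "F \<subseteq> V" "F \<notin> clique_complex V adj" and min: "\<And>G. G \<subset> F \<Longrightarrow> G \<in> clique_complex V adj"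
      using that by (auto simp: minimal_nonface_def)
    from F obtain u v where uv: "u \<in> F" "v \<in> F" "u \<noteq> v" "\<not> adj u v"
      by (auto simp: clique_complex_def)
    then have "{u, v} \<notin> clique_complex V adj"
      by (auto simp: clique_complex_def)
    with min[of "{u, v}"] uv have "F = {u, v}"
      by auto
    with uv show ?thesis by simp
  qed
  moreover have "simplicial_complex_on V (clique_complex V adj)"
    using assms by (auto simp: simplicial_complex_on_def clique_complex_def)
  ultimately show ?thesis
    by (simp add: flag_complex_def)
qed

lemma f0_clique_complex: "f0 (clique_complex V adj) = card V"
proof -
  have "{F \<in> clique_complex V adj. face_dim F = 0} = (\<lambda>v. {v}) ` V"
    by (auto simp: clique_complex_def face_dim_def card_1_singleton_iff)
  then show ?thesis
    by (simp add: f0_def card_image)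
qed

lemma
  assumes "finite V"
  shows card_le_independence_number:
      "S \<subseteq> V \<Longrightarrow> (\<And>u v. u \<in> S \<Longrightarrow> v \<in> S \<Longrightarrow> u \<noteq> v \<Longrightarrow> \<not> adj u v)
        \<Longrightarrow> card S \<le> independence_number (graph_of (clique_complex V adj))"
    and independence_number_le_card:
      "independence_number (graph_of (clique_complex V adj)) \<le> card V"
proof -
  let ?I = "independent_set (graph_of (clique_complex V adj))"
  have sub: "S \<subseteq> V" if "?I S" for S
    using that by (simp add: independent_set_def graph_of_def)
  then have "{card S | S. ?I S} \<subseteq> card ` Pow V"
    by auto
  then have fin: "finite {card S | S. ?I S}"
    using assms by (meson finite_Pow_iff finite_imageI finite_subset)
  have "?I {}"
    by (simp add: independent_set_def)
  then have "{card S | S. ?I S} \<noteq> {}"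
    by blast
  then show "independence_number (graph_of (clique_complex V adj)) \<le> card V"
    unfolding independence_number_def using fin sub assms
    by (subst Max_le_iff) (auto intro: card_mono)
  show "card S \<le> independence_number (graph_of (clique_complex V adj))"
    if "S \<subseteq> V" "\<And>u v. u \<in> S \<Longrightarrow> v \<in> S \<Longrightarrow> u \<noteq> v \<Longrightarrow> \<not> adj u v"
  proof -
    have "{u, v} \<notin> clique_complex V adj" if "u \<in> S" "v \<in> S" "u \<noteq> v" for u v
      using that \<open>\<And>u v. u \<in> S \<Longrightarrow> v \<in> S \<Longrightarrow> u \<noteq> v \<Longrightarrow> \<not> adj u v\<close>
      by (auto simp: clique_complex_def)
    with \<open>S \<subseteq> V\<close> have "?I S"
      by (auto simp: independent_set_def graph_of_def)
    then show ?thesis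
      unfolding independence_number_def using fin by (intro Max_ge) auto
  qed
qed

section \<open>Cones of nonnegative weights\<close>

definition clique_cone :: "'a set \<Rightarrow> ('a \<Rightarrow> 'a \<Rightarrow> bool) \<Rightarrow> ('a \<Rightarrow> real) set" where
  "clique_cone V adj = {x. (\<forall>v. 0 \<le> x v) \<and> {v. x v \<noteq> 0} \<in> clique_complex V adj}"

lemma clique_cone_iff:
  "x \<in> clique_cone V adj \<longleftrightarrow>
     (\<forall>v. 0 \<le> x v) \<and> (\<forall>v. x v \<noteq> 0 \<longrightarrow> v \<in> V) \<and>
     (\<forall>u v. x u \<noteq> 0 \<longrightarrow> x v \<noteq> 0 \<longrightarrow> u \<noteq> v \<longrightarrow> adj u v)"
  by (auto simp: clique_cone_def clique_complex_def)

lemma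
  assumes "x \<in> clique_cone V adj"
  shows clique_cone_nonneg: "0 \<le> x v"
    and clique_cone_zero: "v \<notin> V \<Longrightarrow> x v = 0"
    and clique_cone_supp: "x v \<noteq> 0 \<Longrightarrow> v \<in> V"
    and clique_cone_adj: "x u \<noteq> 0 \<Longrightarrow> x v \<noteq> 0 \<Longrightarrow> u \<noteq> v \<Longrightarrow> adj u v"
  using assms unfolding clique_cone_iff by auto

definition lincomb :: "'a set \<Rightarrow> ('a \<Rightarrow> nat \<Rightarrow> real) \<Rightarrow> ('a \<Rightarrow> real) \<Rightarrow> nat \<Rightarrow> real" where
  "lincomb V \<phi> x = (\<lambda>i. \<Sum>v\<in>V. x v * \<phi> v i)"

text \<open>Vectors indexed by \<open>D\<close> are extended by zero, as in \<open>nsphere\<close>;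
  disjoint index sets then give complementary subspaces, one for each factor of a join.\<close>

definition coord_space :: "nat set \<Rightarrow> (nat \<Rightarrow> real) set" where
  "coord_space D = {y. \<forall>i. i \<notin> D \<longrightarrow> y i = 0}"

text \<open>Injectivity says that the vectors of each face are linearly independent and that two
  cones meet only in the cone of their common face; surjectivity says that the cones cover the
  space. A single bijection thus encodes a complete simplicial fan.\<close>

definition complete_fan :: "nat set \<Rightarrow> 'a set \<Rightarrow> ('a \<Rightarrow> 'a \<Rightarrow> bool) \<Rightarrow> ('a \<Rightarrow> nat \<Rightarrow> real) \<Rightarrow> bool"
  where
  "complete_fan D V adj \<phi> \<longleftrightarrow>
     finite V \<and> bij_betw (lincomb V \<phi>) (clique_cone V adj) (coord_space D)"

lemma lincomb_scale: "lincomb V \<phi> (\<lambda>v. c * x v) = (\<lambda>i. c * lincomb V \<phi> x i)"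
  by (simp add: lincomb_def sum_distrib_left mult.assoc)

lemma clique_cone_scale: "x \<in> clique_cone V adj \<Longrightarrow> 0 \<le> c \<Longrightarrow> (\<lambda>v. c * x v) \<in> clique_cone V adj"
  by (auto simp: clique_cone_iff)

section \<open>From complete fans to spheres\<close>

lemma geometric_realization_clique_complex:
  "geometric_realization (clique_complex V adj) =
     top_of_set (clique_cone V adj \<inter> {x. (\<Sum>v\<in>V. x v) = 1})"
  unfolding geometric_realization_def euclidean_product_topology
  by (rule arg_cong[of _ _ top_of_set]) (auto simp: clique_cone_def)

text \<open>The cone is closed, being the orthant cut with a finite union of closed sets, one for
  each face. Weights of sum 1 lie in a cube that is compact by Tychonoff's theorem. Compactness
  later turns a continuous bijection onto the sphere into a homeomorphism.\<close>

lemma compact_realization: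
  assumes "finite V"
  shows "compact (clique_cone V adj \<inter> {x. (\<Sum>v\<in>V. x v) = 1})" (is "compact ?R")
proof -
  have cont: "continuous_on UNIV (\<lambda>x::'a \<Rightarrow> real. x v)" for v
    by simp
  have fin: "finite (clique_complex V adj)"
    using assms by (auto simp: clique_complex_def intro: finite_subset[of _ "Pow V"])
  have "clique_cone V adj =
      {x. \<forall>v. 0 \<le> x v} \<inter> (\<Union>F\<in>clique_complex V adj. {x. \<forall>v. v \<notin> F \<longrightarrow> x v = 0})" (is "_ = ?C")
  proof (intro equalityI subsetI)
    fix x assume "x \<in> clique_cone V adj"
    then show "x \<in> ?C"
      by (auto simp: clique_cone_def intro!: bexI[of _ "{v. x v \<noteq> 0}"])
  next
    fix x assume "x \<in> ?C"
    then obtain F where "\<forall>v. 0 \<le> x v" "F \<in> clique_complex V adj" "{v. x v \<noteq> 0} \<subseteq> F"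
      by auto
    then show "x \<in> clique_cone V adj"
      unfolding clique_cone_def clique_complex_def by (simp add: subset_iff)
  qed
  moreover have "closed {x::'a \<Rightarrow> real. \<forall>v. v \<notin> F \<longrightarrow> x v = 0}" for F
    by (intro closed_Collect_all closed_Collect_imp closed_Collect_eq cont) auto
  moreover have "closed {x::'a \<Rightarrow> real. \<forall>v. 0 \<le> x v}"
    by (intro closed_Collect_all closed_Collect_le cont continuous_on_const)
  ultimately have "closed (clique_cone V adj)"
    using fin by (simp add: closed_Int closed_UN)
  then have "closed ?R"
    by (intro closed_Int closed_Collect_eq continuous_on_sum cont) auto
  moreover have "compact (PiE UNIV (\<lambda>_::'a. {0..1::real}))"
    using compactin_PiE[of "\<lambda>_::'a. euclidean" UNIV "\<lambda>_. {0..1::real}"]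
    by (simp add: euclidean_product_topology)
  moreover have "?R \<subseteq> PiE UNIV (\<lambda>_. {0..1})"
  proof
    fix x assume x: "x \<in> ?R"
    have "x v \<le> 1" for v
    proof (cases "v \<in> V")
      case True
      with x assms have "x v \<le> (\<Sum>v\<in>V. x v)"
        by (intro member_le_sum) (auto intro: clique_cone_nonneg)
      with x show ?thesis by simp
    next
      case False
      with x have "x v = 0" by (auto intro: clique_cone_zero)
      then show ?thesis by simp
    qed
    with x show "x \<in> PiE UNIV (\<lambda>_. {0..1})"
      by (auto intro: clique_cone_nonneg)
  qed
  ultimately show ?thesis
    by (metis closed_Int_compact inf.absorb1)
qed

lemma homeomorphic_imp_homeomorphic_space:
  "S homeomorphic T \<Longrightarrow> top_of_set S homeomorphic_space top_of_set T"
  unfolding homeomorphic_def homeomorphism_def homeomorphic_space_def homeomorphic_maps_def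
  by (simp add: image_subset_iff_funcset[symmetric]) (metis order_refl)

lemma nsphere_top_of_set:
  "nsphere n = top_of_set {x. (\<Sum>i\<le>n. x i ^ 2) = 1 \<and> (\<forall>i>n. x i = 0)}"
  by (simp add: nsphere euclidean_product_topology)

text \<open>The map \<open>h\<close> is radial projection: it divides the linear extension of
  \<open>\<phi>\<close> by its length. Each ray from the origin meets the image of the realization
  exactly once, since the fan covers every point once and weights scale along with their
  images.\<close>

lemma flag_sphere_clique_complex:
  assumes fan: "complete_fan {..n} V adj \<phi>"
  shows "flag_sphere n (clique_complex V adj)"
proof -
  define R where "R = clique_cone V adj \<inter> {x. (\<Sum>v\<in>V. x v) = 1}"
  define S where "S = {y::nat \<Rightarrow> real. (\<Sum>i\<le>n. y i ^ 2) = 1 \<and> (\<forall>i>n. y i = 0)}"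
  define N where "N y = sqrt (\<Sum>i\<le>n. y i ^ 2)" for y :: "nat \<Rightarrow> real"
  let ?f = "lincomb V \<phi>"
  define h where "h x = (\<lambda>i. ?f x i / N (?f x))" for x
  have finV: "finite V" and bij: "bij_betw ?f (clique_cone V adj) (coord_space {..n})"
    using fan by (auto simp: complete_fan_def)
  have zero: "(\<lambda>_. 0) \<in> clique_cone V adj" "?f (\<lambda>_. 0) = (\<lambda>_. 0)"
    by (auto simp: clique_cone_iff lincomb_def)
  have coord: "?f x \<in> coord_space {..n}" if "x \<in> R" for x
    using bij that by (auto simp: R_def bij_betw_def)
  \<comment> \<open>By injectivity only the zero weight has image zero, and its sum is not
    1.\<close>
  have Npos: "N (?f x) > 0" if "x \<in> R" for x
  proof (rule ccontr)
    assume "\<not> N (?f x) > 0"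
    moreover have "(\<Sum>i\<le>n. ?f x i ^ 2) \<ge> 0"
      by (simp add: sum_nonneg)
    ultimately have "(\<Sum>i\<le>n. ?f x i ^ 2) = 0"
      by (auto simp: N_def)
    then have "?f x i = 0" if "i \<le> n" for i
      using that by (subst (asm) sum_nonneg_eq_0_iff) auto
    with coord[OF that] have "?f x = ?f (\<lambda>_. 0)"
      unfolding zero by (auto simp: coord_space_def)
    moreover have "x \<in> clique_cone V adj"
      using that by (simp add: R_def)
    ultimately have "x = (\<lambda>_. 0)"
      using bij zero(1) unfolding bij_betw_def by (metis inj_onD)
    with that show False by (simp add: R_def)
  qed
  have "R homeomorphic S"
  proof (rule homeomorphic_compact[of R h S])
    show "compact R"
      unfolding R_def by (rule compact_realization[OF finV])
    have cf: "continuous_on R (\<lambda>x. ?f x i)" for i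
      unfolding lincomb_def
      by (intro continuous_on_sum continuous_on_mult continuous_on_const)
        (metis continuous_on_product_coordinates continuous_on_subset subset_UNIV)
    show "continuous_on R h"
      unfolding h_def
    proof (rule continuous_on_coordinatewise_then_product, rule continuous_on_divide)
      show "continuous_on R (\<lambda>x. N (?f x))"
        unfolding N_def by (intro continuous_on_real_sqrt continuous_on_sum continuous_on_power cf)
      show "\<forall>x\<in>R. N (?f x) \<noteq> 0"
        using Npos by force
    qed (rule cf)
    show "inj_on h R"
    proof (rule inj_onI)
      fix x y assume xy: "x \<in> R" "y \<in> R" "h x = h y"
      \<comment> \<open>Points with the same projection have images that differ by the factor
        \<open>c\<close>. Homogeneity and injectivity carry this factor back to the weights, whose
        sums, both 1, force \<open>c = 1\<close>.\<close>
      define c where "c = N (?f x) / N (?f y)"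
      have c: "c \<ge> 0"
        using Npos[OF xy(1)] Npos[OF xy(2)] by (simp add: c_def)
      have "?f x i = c * ?f y i" for i
        using fun_cong[OF xy(3), of i] Npos[OF xy(1)] Npos[OF xy(2)]
        by (simp add: h_def c_def field_simps)
      then have "?f x = ?f (\<lambda>v. c * y v)"
        by (auto simp: lincomb_scale)
      moreover have "(\<lambda>v. c * y v) \<in> clique_cone V adj" "x \<in> clique_cone V adj"
        using xy c by (auto simp: R_def intro: clique_cone_scale)
      ultimately have x: "x = (\<lambda>v. c * y v)"
        using bij by (auto simp: bij_betw_def dest: inj_onD)
      then have "(\<Sum>v\<in>V. x v) = c * (\<Sum>v\<in>V. y v)"
        by (simp add: sum_distrib_left)
      with xy have "c = 1" by (simp add: R_def)
      with x show "x = y" by simp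
    qed
    show "h ` R = S"
    proof (intro equalityI subsetI)
      fix y assume "y \<in> h ` R"
      then obtain x where x: "x \<in> R" "y = h x" by auto
      have "N (?f x) ^ 2 = (\<Sum>i\<le>n. ?f x i ^ 2)"
        by (simp add: N_def sum_nonneg)
      then have "(\<Sum>i\<le>n. y i ^ 2) = 1"
        using Npos[OF x(1)] by (auto simp: x h_def power_divide simp flip: sum_divide_distrib)
      with coord[OF x(1)] show "y \<in> S"
        by (auto simp: S_def x(2) h_def coord_space_def)
    next
      fix y assume y: "y \<in> S"
      then have "y \<in> coord_space {..n}" by (auto simp: S_def coord_space_def)
      then obtain x where x: "x \<in> clique_cone V adj" "y = ?f x"
        using bij by (auto simp: bij_betw_def)
      \<comment> \<open>Dividing the preimage \<open>x\<close> by its total weight \<open>s\<close>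
        gives a point of the realization on the same ray. The total is nonzero because the sphere
        avoids the origin.\<close>
      define s where "s = (\<Sum>v\<in>V. x v)"
      have "s \<noteq> 0"
      proof
        assume "s = 0"
        then have "x v = 0" if "v \<in> V" for v
          using clique_cone_nonneg[OF x(1)] finV that unfolding s_def
          by (simp add: sum_nonneg_eq_0_iff)
        then have "y = (\<lambda>_. 0)"
          by (simp add: x lincomb_def)
        with y show False by (simp add: S_def)
      qed
      moreover have "s \<ge> 0"
        unfolding s_def by (rule sum_nonneg) (rule clique_cone_nonneg[OF x(1)])
      ultimately have s: "s > 0" by simp
      let ?x = "\<lambda>v. inverse s * x v"
      have "?x \<in> R"
        using s clique_cone_scale[OF x(1), of "inverse s"]
        by (simp add: R_def s_def flip: sum_distrib_left)
      moreover have "h ?x = y"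
      proof -
        have "N (?f ?x) = inverse s * N y"
          using s by (simp add: lincomb_scale N_def power_mult_distrib real_sqrt_mult x(2) real_sqrt_divide
              power_divide real_sqrt_inverse flip: sum_distrib_left sum_divide_distrib)
        moreover have "N y = 1" using y by (simp add: N_def S_def)
        ultimately show ?thesis
          using s by (simp add: h_def lincomb_scale x(2))
      qed
      ultimately show "y \<in> h ` R" by (metis imageI)
    qed
  qed
  then have "top_of_set R homeomorphic_space top_of_set S"
    by (rule homeomorphic_imp_homeomorphic_space)
  then show ?thesis
    using flag_complex_clique_complex[OF finV]
    by (simp add: flag_sphere_def geometric_realization_clique_complex nsphere_top_of_set R_def S_def)
qed

section \<open>Joins and edge subdivisions of complete fans\<close>

text \<open>Relabelling along a bijection only permutes the coordinates of the weights. It serves to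
  replace pairs by natural numbers as vertices.\<close>

lemma complete_fan_reindex:
  assumes fan: "complete_fan D V adj \<phi>" and g: "bij g"
  shows "complete_fan D (g -` V) (\<lambda>u v. adj (g u) (g v)) (\<lambda>v. \<phi> (g v))"
proof -
  let ?V = "g -` V" and ?adj = "\<lambda>u v. adj (g u) (g v)"
  have g_inv: "g (inv g v) = v" "inv g (g w) = w" for v w
    using g by (auto simp: bij_is_surj surj_f_inv_f bij_is_inj)
  have "bij_betw (\<lambda>x v. x (inv g v)) (clique_cone ?V ?adj) (clique_cone V adj)"
  proof (rule bij_betw_byWitness[where f' = "\<lambda>x v. x (g v)"])
    have *: "inv g u \<noteq> inv g v" if "u \<noteq> v" for u v
      using that g_inv(1) by metis
    have **: "g u \<noteq> g v" if "u \<noteq> v" for u v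
      using that g_inv(2) by metis
    show "(\<lambda>x v. x (inv g v)) ` clique_cone ?V ?adj \<subseteq> clique_cone V adj"
    proof (rule image_subsetI)
      fix x assume "x \<in> clique_cone ?V ?adj"
      then have "0 \<le> x (inv g v)" "x (inv g v) \<noteq> 0 \<longrightarrow> v \<in> V"
        "x (inv g u) \<noteq> 0 \<longrightarrow> x (inv g v) \<noteq> 0 \<longrightarrow> inv g u \<noteq> inv g v \<longrightarrow> adj u v" for u v
        by (auto simp: clique_cone_iff) (metis g_inv(1))+
      with * show "(\<lambda>v. x (inv g v)) \<in> clique_cone V adj"
        by (simp add: clique_cone_iff)
    qed
    show "(\<lambda>x v. x (g v)) ` clique_cone V adj \<subseteq> clique_cone ?V ?adj"
      using ** by (auto simp: clique_cone_iff)
  qed (simp_all add: g_inv)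
  then have "bij_betw (lincomb V \<phi> \<circ> (\<lambda>x v. x (inv g v))) (clique_cone ?V ?adj) (coord_space D)"
    using fan by (auto simp: complete_fan_def intro: bij_betw_trans)
  moreover have "bij_betw g ?V V"
    using g by (auto simp: bij_betw_def bij_def intro: inj_on_subset)
  then have "lincomb V \<phi> \<circ> (\<lambda>x v. x (inv g v)) = lincomb ?V (\<lambda>v. \<phi> (g v))"
    using g by (auto simp: lincomb_def bij_is_inj simp flip: sum.reindex_bij_betw)
  moreover have "finite ?V"
    using fan g by (auto simp: complete_fan_def bij_is_inj intro: finite_vimageI)
  ultimately show ?thesis
    by (simp add: complete_fan_def)
qed

text \<open>All pairs across the factors being adjacent, a weight on the join is an arbitrary pair
  of weights on the factors. Its image is the sum of two images that lie in complementary
  subspaces.\<close>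

lemma complete_fan_join:
  assumes fan: "complete_fan D V adj \<phi>" and fan': "complete_fan D' V' adj \<phi>"
    and disj: "V \<inter> V' = {}" "D \<inter> D' = {}"
    and adj: "\<And>u v. u \<in> V \<Longrightarrow> v \<in> V' \<Longrightarrow> adj u v \<and> adj v u"
  shows "complete_fan (D \<union> D') (V \<union> V') adj \<phi>"
proof -
  have fin: "finite V" "finite V'"
    and bij: "bij_betw (lincomb V \<phi>) (clique_cone V adj) (coord_space D)"
      "bij_betw (lincomb V' \<phi>) (clique_cone V' adj) (coord_space D')"
    using fan fan' by (auto simp: complete_fan_def)
  have disjD: "i \<notin> D \<or> i \<notin> D'" for i
    using disj(2) by blast
  define cut where "cut W x = (\<lambda>v. if v \<in> W then x v else (0::real))" for W :: "'a set" and x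
  have cut: "cut W x \<in> clique_cone W adj" if "x \<in> clique_cone (V \<union> V') adj" for x W
    using that by (auto simp: clique_cone_iff cut_def split: if_splits)
  have split: "lincomb (V \<union> V') \<phi> x i = lincomb V \<phi> (cut V x) i + lincomb V' \<phi> (cut V' x) i" for x i
    using fin disj by (simp add: lincomb_def sum.union_disjoint cut_def)
  have lc: "lincomb V \<phi> x i = 0" if "x \<in> clique_cone V adj" "i \<notin> D" for x i
    using bij(1) that by (auto simp: bij_betw_def coord_space_def)
  have lc': "lincomb V' \<phi> x i = 0" if "x \<in> clique_cone V' adj" "i \<notin> D'" for x i
    using bij(2) that by (auto simp: bij_betw_def coord_space_def)
  have "inj_on (lincomb (V \<union> V') \<phi>) (clique_cone (V \<union> V') adj)"
  proof (rule inj_onI)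
    fix x y assume x: "x \<in> clique_cone (V \<union> V') adj" and y: "y \<in> clique_cone (V \<union> V') adj"
      and "lincomb (V \<union> V') \<phi> x = lincomb (V \<union> V') \<phi> y"
    then have eq: "lincomb V \<phi> (cut V x) i + lincomb V' \<phi> (cut V' x) i
        = lincomb V \<phi> (cut V y) i + lincomb V' \<phi> (cut V' y) i" for i
      by (simp flip: split)
    \<comment> \<open>Since \<open>D\<close> and \<open>D'\<close> are disjoint, at most one of the
      two summands can be nonzero in coordinate \<open>i\<close>, so the equality of sums
      splits.\<close>
    have "lincomb V \<phi> (cut V x) i = lincomb V \<phi> (cut V y) i" for i
      using eq[of i] disjD[of i] lc[OF cut[OF x], of i] lc[OF cut[OF y], of i]
        lc'[OF cut[OF x], of i] lc'[OF cut[OF y], of i] by (cases "i \<in> D") auto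
    moreover have "lincomb V' \<phi> (cut V' x) i = lincomb V' \<phi> (cut V' y) i" for i
      using eq[of i] disjD[of i] lc[OF cut[OF x], of i] lc[OF cut[OF y], of i]
        lc'[OF cut[OF x], of i] lc'[OF cut[OF y], of i] by (cases "i \<in> D'") auto
    ultimately have "lincomb V \<phi> (cut V x) = lincomb V \<phi> (cut V y)"
      "lincomb V' \<phi> (cut V' x) = lincomb V' \<phi> (cut V' y)"
      by auto
    then have "cut V x = cut V y" "cut V' x = cut V' y"
      using bij cut[OF x] cut[OF y] unfolding bij_betw_def by (metis inj_onD)+
    then have "x v = y v" if "v \<in> V \<union> V'" for v
      using that by (metis cut_def Un_iff)
    moreover have "x v = y v" if "v \<notin> V \<union> V'" for v
    proof -
      have "x v = 0" "y v = 0"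
        using that clique_cone_zero[OF x] clique_cone_zero[OF y] by auto
      then show ?thesis by simp
    qed
    ultimately show "x = y"
      by blast
  qed
  moreover have "lincomb (V \<union> V') \<phi> ` clique_cone (V \<union> V') adj = coord_space (D \<union> D')"
  proof (intro equalityI subsetI)
    fix y assume "y \<in> lincomb (V \<union> V') \<phi> ` clique_cone (V \<union> V') adj"
    then show "y \<in> coord_space (D \<union> D')"
      using lc lc' cut by (auto simp: coord_space_def split)
  next
    fix y assume y: "y \<in> coord_space (D \<union> D')"
    have "(\<lambda>i. if i \<in> D then y i else 0) \<in> coord_space D"
      "(\<lambda>i. if i \<in> D' then y i else 0) \<in> coord_space D'"
      by (auto simp: coord_space_def)
    then obtain x x' where x: "x \<in> clique_cone V adj" "lincomb V \<phi> x = (\<lambda>i. if i \<in> D then y i else 0)"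
      and x': "x' \<in> clique_cone V' adj" "lincomb V' \<phi> x' = (\<lambda>i. if i \<in> D' then y i else 0)"
      using bij unfolding bij_betw_def by (metis (no_types, lifting) imageE)
    have supp: "x v \<noteq> 0 \<Longrightarrow> v \<in> V" "x u \<noteq> 0 \<Longrightarrow> x v \<noteq> 0 \<Longrightarrow> u \<noteq> v \<Longrightarrow> adj u v" for u v
      by (rule clique_cone_supp[OF x(1)] clique_cone_adj[OF x(1)]; assumption)+
    have supp': "x' v \<noteq> 0 \<Longrightarrow> v \<in> V'" "x' u \<noteq> 0 \<Longrightarrow> x' v \<noteq> 0 \<Longrightarrow> u \<noteq> v \<Longrightarrow> adj u v" for u v
      by (rule clique_cone_supp[OF x'(1)] clique_cone_adj[OF x'(1)]; assumption)+
    define z where "z v = x v + x' v" for v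
    have z: "z \<in> clique_cone (V \<union> V') adj"
      unfolding clique_cone_iff
    proof (intro conjI allI impI)
      show "0 \<le> z v" for v
        by (simp add: z_def clique_cone_nonneg[OF x(1)] clique_cone_nonneg[OF x'(1)])
      show "v \<in> V \<union> V'" if "z v \<noteq> 0" for v
      proof -
        have "x v \<noteq> 0 \<or> x' v \<noteq> 0"
          using that by (auto simp: z_def)
        then show ?thesis
          by (metis UnI1 UnI2 supp(1) supp'(1))
      qed
      show "adj u v" if "z u \<noteq> 0" "z v \<noteq> 0" "u \<noteq> v" for u v
      proof -
        have "x u \<noteq> 0 \<or> x' u \<noteq> 0" "x v \<noteq> 0 \<or> x' v \<noteq> 0"
          using that by (auto simp: z_def)
        then show ?thesis
          by (metis supp supp' that(3) adj)
      qed
    qed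
    have "x v = 0" if "v \<in> V'" for v
      using that disj(1) by (intro clique_cone_zero[OF x(1)]) blast
    moreover have "x' v = 0" if "v \<in> V" for v
      using that disj(1) by (intro clique_cone_zero[OF x'(1)]) blast
    moreover have "x v = 0" if "v \<notin> V" for v
      using that by (rule clique_cone_zero[OF x(1)])
    moreover have "x' v = 0" if "v \<notin> V'" for v
      using that by (rule clique_cone_zero[OF x'(1)])
    ultimately have "cut V z = x" "cut V' z = x'"
      by (auto simp: cut_def z_def)
    then have "lincomb (V \<union> V') \<phi> z i = y i" for i
      using y disjD[of i] x(2) x'(2) by (auto simp: split coord_space_def)
    then have "y = lincomb (V \<union> V') \<phi> z"
      by auto
    with z show "y \<in> lincomb (V \<union> V') \<phi> ` clique_cone (V \<union> V') adj"
      by blast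
  qed
  ultimately show ?thesis
    using fin by (simp add: complete_fan_def bij_betw_def)
qed

text \<open>At most one of two non-adjacent points carries weight, so \<open>x a - x b\<close> takes
  every real value exactly once. This zero-sphere is the building block of the four-cycle and of the
  suspensions.\<close>

lemma complete_fan_two_points:
  assumes "a \<noteq> b" "\<not> adj a b"
    and \<phi>: "\<And>j. \<phi> a j = (if j = i then 1 else 0)" "\<And>j. \<phi> b j = (if j = i then -1 else 0)"
  shows "complete_fan {i} {a, b} adj \<phi>"
proof -
  have lc: "lincomb {a, b} \<phi> x = (\<lambda>j. if j = i then x a - x b else 0)" for x
    using assms by (auto simp: lincomb_def)
  have "inj_on (lincomb {a, b} \<phi>) (clique_cone {a, b} adj)"
  proof (rule inj_onI)
    fix x y assume x: "x \<in> clique_cone {a, b} adj" and y: "y \<in> clique_cone {a, b} adj"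
      and eq: "lincomb {a, b} \<phi> x = lincomb {a, b} \<phi> y"
    from fun_cong[OF eq, of i] have "x a - x b = y a - y b"
      by (simp add: lc)
    moreover have "x a = 0 \<or> x b = 0" "y a = 0 \<or> y b = 0"
      using assms(1,2) x y unfolding clique_cone_iff by metis+
    moreover note clique_cone_nonneg[OF x, of a] clique_cone_nonneg[OF x, of b]
      clique_cone_nonneg[OF y, of a] clique_cone_nonneg[OF y, of b]
    ultimately have "x a = y a \<and> x b = y b"
      by linarith
    moreover have "x v = y v" if "v \<noteq> a" "v \<noteq> b" for v
    proof -
      have "x v = 0" "y v = 0"
        using that clique_cone_zero[OF x] clique_cone_zero[OF y] by auto
      then show ?thesis by simp
    qed
    ultimately show "x = y"
      by (metis ext)
  qed
  moreover have "lincomb {a, b} \<phi> ` clique_cone {a, b} adj = coord_space {i}"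
  proof (intro equalityI subsetI)
    fix y assume "y \<in> coord_space {i}"
    \<comment> \<open>The weights of \<open>a\<close> and \<open>b\<close> are the positive and the
      negative part of \<open>y i\<close>.\<close>
    define x where "x v = (if v = a then max 0 (y i) else if v = b then max 0 (- y i) else 0)" for v
    have "x a = 0 \<or> x b = 0"
      using assms(1) by (simp add: x_def max_def)
    moreover have "0 \<le> x v" "x v \<noteq> 0 \<longrightarrow> v = a \<or> v = b" for v
      by (simp_all add: x_def)
    ultimately have "x \<in> clique_cone {a, b} adj"
      unfolding clique_cone_iff by (metis insertCI)
    moreover have "y = lincomb {a, b} \<phi> x"
      using \<open>y \<in> coord_space {i}\<close> assms(1) by (auto simp: lc x_def coord_space_def fun_eq_iff)
    ultimately show "y \<in> lincomb {a, b} \<phi> ` clique_cone {a, b} adj"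
      by blast
  qed (auto simp: lc coord_space_def)
  ultimately show ?thesis
    by (simp add: complete_fan_def bij_betw_def)
qed

text \<open>
  The edges in \<open>E\<close> are subdivided simultaneously. As no clique contains two of them, the new point \<open>m (a, b)\<close> receives the coordinate \<open>min (x a) (x b)\<close>, which is taken away
  from both \<open>a\<close> and \<open>b\<close>.
\<close>

lemma complete_fan_subdivide:
  assumes fan: "complete_fan D V adj \<phi>"
    and sym: "\<And>u v. adj u v \<Longrightarrow> adj v u"
    and E: "\<And>a b. (a, b) \<in> E \<Longrightarrow> a \<in> V \<and> b \<in> V \<and> a \<noteq> b \<and> adj a b"
    and E_unique: "\<And>a b c d F. (a, b) \<in> E \<Longrightarrow> (c, d) \<in> E \<Longrightarrow> F \<in> clique_complex V adj \<Longrightarrow>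
          {a, b, c, d} \<subseteq> F \<Longrightarrow> (a, b) = (c, d)"
    and m: "inj_on m E" "m ` E \<inter> V = {}"
    and old: "\<And>u v. u \<in> V \<Longrightarrow> v \<in> V \<Longrightarrow> adj' u v \<longleftrightarrow> adj u v \<and> (u, v) \<notin> E \<and> (v, u) \<notin> E"
    and new: "\<And>a b v. (a, b) \<in> E \<Longrightarrow> v \<in> V \<Longrightarrow>
          adj' (m (a, b)) v \<longleftrightarrow> v = a \<or> v = b \<or> adj a v \<and> adj b v"
    and new': "\<And>a b v. (a, b) \<in> E \<Longrightarrow> v \<in> V \<Longrightarrow> adj' v (m (a, b)) \<longleftrightarrow> adj' (m (a, b)) v"
    and new_indep: "\<And>e e'. e \<in> E \<Longrightarrow> e' \<in> E \<Longrightarrow> e \<noteq> e' \<Longrightarrow> \<not> adj' (m e) (m e')"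
    and \<psi>_old: "\<And>v. v \<in> V \<Longrightarrow> \<psi> v = \<phi> v"
    and \<psi>_new: "\<And>a b i. (a, b) \<in> E \<Longrightarrow> \<psi> (m (a, b)) i = \<phi> a i + \<phi> b i"
  shows "complete_fan D (V \<union> m ` E) adj' \<psi>"
proof -
  let ?C = "clique_cone V adj" and ?C' = "clique_cone (V \<union> m ` E) adj'"
  have finV: "finite V" and bij: "bij_betw (lincomb V \<phi>) ?C (coord_space D)"
    using fan by (auto simp: complete_fan_def)
  have finE: "finite E"
    by (rule finite_subset[of _ "V \<times> V"]) (use E finV in auto)
  define inc where "inc e v = (if v = fst e \<or> v = snd e then 1 else 0 :: real)"
    for e :: "'a \<times> 'a" and v
  \<comment> \<open>\<open>flat\<close> undoes the subdivision on weights: each midpoint passes its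
    weight on to both ends of its edge. The proof shows that it is a bijection of the cones and that
    it turns \<open>lincomb\<close> with \<open>\<phi>\<close> into \<open>lincomb\<close> with
    \<open>\<psi>\<close>.\<close>
  define flat where "flat x v = (if v \<in> V then x v + (\<Sum>e\<in>E. x (m e) * inc e v) else 0)"
    for x :: "'a \<Rightarrow> real" and v
  have flat_single: "flat x v = x v + x (m e) * inc e v"
    if "v \<in> V" "e \<in> E" "\<And>e'. e' \<in> E \<Longrightarrow> e' \<noteq> e \<Longrightarrow> x (m e') = 0" for x v e
  proof -
    have "(\<Sum>e\<in>E. x (m e) * inc e v) = (\<Sum>e\<in>{e}. x (m e) * inc e v)"
      using that finE by (intro sum.mono_neutral_right) auto
    with that(1) show ?thesis by (simp add: flat_def)
  qed
  have flat_none: "flat x v = x v" if "v \<in> V" "\<And>e'. e' \<in> E \<Longrightarrow> x (m e') = 0" for x v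
    using that by (simp add: flat_def)
  have mV: "m e \<notin> V" if "e \<in> E" for e
    using m(2) that by auto
  have unique: "e = e'" if "x \<in> ?C'" "e \<in> E" "e' \<in> E" "x (m e) \<noteq> 0" "x (m e') \<noteq> 0" for x e e'
  proof (rule ccontr)
    assume "e \<noteq> e'"
    with m(1) that have "m e \<noteq> m e'"
      by (auto dest: inj_onD)
    with that have "adj' (m e) (m e')"
      using clique_cone_adj[OF that(1), of "m e" "m e'"] by simp
    with new_indep[OF that(2,3) \<open>e \<noteq> e'\<close>] show False ..
  qed
  have flat_cone: "flat x \<in> ?C" if x: "x \<in> ?C'" for x
  proof -
    note nonneg = clique_cone_nonneg[OF x]
    have supp: "x u \<noteq> 0 \<or> (\<exists>a b. (a, b) \<in> E \<and> x (m (a, b)) \<noteq> 0 \<and> (u = a \<or> u = b))"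
      if "flat x u \<noteq> 0" for u
    proof (rule ccontr)
      assume contr: "\<not> ?thesis"
      then have "x (m e) * inc e u = 0" if "e \<in> E" for e
        using that by (cases e) (auto simp: inc_def)
      then have "(\<Sum>e\<in>E. x (m e) * inc e u) = 0"
        by (intro sum.neutral) blast
      then show False
        using that contr by (simp add: flat_def split: if_splits)
    qed
    have mixed: "adj u v" if "u \<in> V" "x u \<noteq> 0" "(a, b) \<in> E" "x (m (a, b)) \<noteq> 0" "v = a \<or> v = b" "u \<noteq> v"
      for u v a b
    proof -
      have "adj' (m (a, b)) u"
        using that mV[of "(a, b)"] by (intro clique_cone_adj[OF x]) auto
      then have "u = a \<or> u = b \<or> adj a u \<and> adj b u"
        using new[OF that(3,1)] by simp
      with that E[OF that(3)] sym show ?thesis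
        by blast
    qed
    have "adj u v" if "flat x u \<noteq> 0" "flat x v \<noteq> 0" "u \<noteq> v" for u v
    proof -
      have V: "u \<in> V" "v \<in> V"
        using that by (auto simp: flat_def split: if_splits)
      note supps = supp[OF that(1)] supp[OF that(2)]
      consider "x u \<noteq> 0" "x v \<noteq> 0"
        | a b where "x u \<noteq> 0" "(a, b) \<in> E" "x (m (a, b)) \<noteq> 0" "v = a \<or> v = b"
        | a b where "x v \<noteq> 0" "(a, b) \<in> E" "x (m (a, b)) \<noteq> 0" "u = a \<or> u = b"
        | a b c d where "(a, b) \<in> E" "x (m (a, b)) \<noteq> 0" "u = a \<or> u = b"
          "(c, d) \<in> E" "x (m (c, d)) \<noteq> 0" "v = c \<or> v = d"
        using supps by blast
      then show ?thesis
      proof cases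
        case 1
        then have "adj' u v"
          using that(3) by (intro clique_cone_adj[OF x])
        with V old show ?thesis by blast
      next
        case 2
        with mixed V that(3) show ?thesis by blast
      next
        case 3
        with mixed V that(3) sym show ?thesis by metis
      next
        case 4
        with unique[OF x] have "(a, b) = (c, d)" by blast
        with 4 E sym that(3) show ?thesis by blast
      qed
    qed
    moreover have "0 \<le> flat x v" for v
      using nonneg by (auto simp: flat_def inc_def intro!: add_nonneg_nonneg sum_nonneg)
    ultimately show ?thesis
      by (auto simp: clique_cone_iff flat_def split: if_splits)
  qed
  have flat_clique: "{v. flat x v \<noteq> 0} \<in> clique_complex V adj" if "x \<in> ?C'" for x
    using flat_cone[OF that] by (simp add: clique_cone_def)
  \<comment> \<open>The ends are no longer adjacent, so at most one of them keeps weight of its own;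
    the smaller flattened value is then the weight of the midpoint. This makes \<open>flat\<close>
    injective.\<close>
  have recover: "x (m (a, b)) = min (flat x a) (flat x b)" if x: "x \<in> ?C'" and ab: "(a, b) \<in> E" for x a b
  proof -
    note nonneg = clique_cone_nonneg[OF x]
    have V: "a \<in> V" "b \<in> V" "a \<noteq> b"
      using E[OF ab] by auto
    have "\<not> adj' a b"
      using old[OF V(1,2)] ab by blast
    then have zero: "x a = 0 \<or> x b = 0"
      using V clique_cone_adj[OF x, of a b] by auto
    show ?thesis
    proof (cases "x (m (a, b)) = 0")
      case False
      with unique[OF x] ab have "\<And>e'. e' \<in> E \<Longrightarrow> e' \<noteq> (a, b) \<Longrightarrow> x (m e') = 0"
        by blast
      then have "flat x a = x a + x (m (a, b))" "flat x b = x b + x (m (a, b))"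
        using flat_single[of _ "(a, b)"] V ab by (auto simp: inc_def)
      with zero nonneg[of a] nonneg[of b] show ?thesis
        by (auto simp: min_def)
    next
      case True
      \<comment> \<open>Were both values nonzero, a midpoint with nonzero weight would place its
        edge and \<open>(a, b)\<close> in one clique, against \<open>E_unique\<close>. So every
        midpoint would have weight zero, and \<open>a\<close> and \<open>b\<close> would both carry
        weight of their own.\<close>
      have "flat x a = 0 \<or> flat x b = 0"
      proof (rule ccontr)
        assume nz: "\<not> ?thesis"
        have "x (m e) = 0" if "e \<in> E" for e
        proof (rule ccontr)
          obtain c d where e: "e = (c, d)" by (cases e)
          assume "x (m e) \<noteq> 0"
          with unique[OF x] that have others: "\<And>e'. e' \<in> E \<Longrightarrow> e' \<noteq> e \<Longrightarrow> x (m e') = 0"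
            by blast
          have "flat x c = x c + x (m e)" "flat x d = x d + x (m e)"
            using flat_single[of _ e x] others E that unfolding e by (auto simp: inc_def)
          then have "flat x c \<noteq> 0" "flat x d \<noteq> 0"
            using nonneg[of c] nonneg[of d] nonneg[of "m e"] \<open>x (m e) \<noteq> 0\<close> by linarith+
          then have "(a, b) = (c, d)"
            using E_unique[OF ab _ flat_clique[OF x]] nz that e by auto
          with True \<open>x (m e) \<noteq> 0\<close> e show False by simp
        qed
        with flat_none V have "flat x a = x a" "flat x b = x b" by auto
        with zero nz show False by auto
      qed
      moreover have "0 \<le> flat x a" "0 \<le> flat x b"
        by (rule clique_cone_nonneg[OF flat_cone[OF x]])+
      ultimately show ?thesis
        using True by (auto simp: min_def)
    qed
  qed
  have "bij_betw flat ?C' ?C"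
    unfolding bij_betw_def
  proof (intro conjI inj_onI equalityI subsetI)
    fix x y assume x: "x \<in> ?C'" and y: "y \<in> ?C'" and eq: "flat x = flat y"
    have mm: "x (m e) = y (m e)" if "e \<in> E" for e
      using recover[OF x] recover[OF y] that eq by (cases e) auto
    moreover have "x v = y v" if "v \<in> V" for v
    proof -
      have "(\<Sum>e\<in>E. x (m e) * inc e v) = (\<Sum>e\<in>E. y (m e) * inc e v)"
        using mm by simp
      with fun_cong[OF eq, of v] that show ?thesis
        by (simp add: flat_def)
    qed
    moreover have "x v = y v" if "v \<notin> V \<union> m ` E" for v
    proof -
      have "x v = 0" "y v = 0"
        by (rule clique_cone_zero[OF x that] clique_cone_zero[OF y that])+
      then show ?thesis by simp
    qed
    ultimately show "x = y"
      by blast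
  next
    fix x assume "x \<in> flat ` ?C'"
    then show "x \<in> ?C"
      using flat_cone by auto
  next
    fix x assume x: "x \<in> ?C"
    note nonneg = clique_cone_nonneg[OF x]
    have clique: "{v. x v \<noteq> 0} \<in> clique_complex V adj"
      using x by (simp add: clique_cone_def)
    show "x \<in> flat ` ?C'"
    proof (cases "\<exists>a b. (a, b) \<in> E \<and> x a \<noteq> 0 \<and> x b \<noteq> 0")
      \<comment> \<open>When the support contains no edge of \<open>E\<close>, the weight is its own
        preimage.\<close>
      case False
      have "x \<in> ?C'"
        unfolding clique_cone_iff
      proof (intro conjI allI impI)
        fix u v assume uv: "x u \<noteq> 0" "x v \<noteq> 0" "u \<noteq> v"
        then have "u \<in> V" "v \<in> V" "adj u v"
          using clique_cone_supp[OF x] clique_cone_adj[OF x] by simp_all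
        with uv False old show "adj' u v" by blast
      qed (use x in \<open>auto simp: clique_cone_iff\<close>)
      moreover have "x (m e) = 0" if "e \<in> E" for e
        by (rule clique_cone_zero[OF x mV[OF that]])
      then have "flat x = x"
        using clique_cone_zero[OF x] by (auto simp: flat_def fun_eq_iff)
      ultimately show ?thesis by (metis imageI)
    next
      case True
      then obtain a b where ab: "(a, b) \<in> E" "x a \<noteq> 0" "x b \<noteq> 0" by blast
      have V: "a \<in> V" "b \<in> V" "a \<noteq> b"
        using E[OF ab(1)] by auto
      \<comment> \<open>The largest amount that both ends can give up; moving it to the midpoint
        empties at least one end, as the removal of the edge \<open>ab\<close> requires.\<close>
      define t where "t = min (x a) (x b)"
      have t: "t > 0" "t \<le> x a" "t \<le> x b" "t = x a \<or> t = x b"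
        using ab nonneg[of a] nonneg[of b] by (auto simp: t_def)
      define y where "y v = (if v = m (a, b) then t else if v = a \<or> v = b then x v - t else x v)" for v
      have y_m: "y (m e) = (if e = (a, b) then t else 0)" if "e \<in> E" for e
      proof -
        have "m e = m (a, b) \<longleftrightarrow> e = (a, b)"
          using m(1) that ab(1) by (auto dest: inj_onD)
        moreover have "m e \<noteq> a" "m e \<noteq> b" "x (m e) = 0"
          using mV[OF that] V clique_cone_zero[OF x mV[OF that]] by auto
        ultimately show ?thesis
          by (simp add: y_def)
      qed
      have ym: "m (a, b) \<noteq> v" if "v \<in> V" for v
        using mV[OF ab(1)] that by auto
      have y_x: "x v \<noteq> 0 \<and> v \<in> V" if "y v \<noteq> 0" "v \<noteq> m (a, b)" for v
        using that ab clique_cone_supp[OF x] by (auto simp: y_def split: if_splits)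
      have adj_new: "adj' (m (a, b)) v \<and> adj' v (m (a, b))" if "v \<in> V" "x v \<noteq> 0" for v
        using that ab clique_cone_adj[OF x, of a v] clique_cone_adj[OF x, of b v]
          new[OF ab(1) that(1)] new'[OF ab(1) that(1)] by auto
      have "y \<in> ?C'"
        unfolding clique_cone_iff
      proof (intro conjI allI impI)
        show "0 \<le> y v" for v
          using t nonneg by (auto simp: y_def)
        show "v \<in> V \<union> m ` E" if "y v \<noteq> 0" for v
          using y_x[OF that] ab(1) by blast
        fix u v assume uv: "y u \<noteq> 0" "y v \<noteq> 0" "u \<noteq> v"
        show "adj' u v"
        proof (cases "u = m (a, b) \<or> v = m (a, b)")
          case True
          with uv y_x adj_new show ?thesis by metis
        next
          case False
          with uv y_x have *: "x u \<noteq> 0" "u \<in> V" "x v \<noteq> 0" "v \<in> V" by auto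
          then have "adj u v"
            using uv(3) by (intro clique_cone_adj[OF x])
          \<comment> \<open>By uniqueness the only candidate is \<open>(a, b)\<close>, and one of
            its ends has been emptied.\<close>
          moreover have "(u', v') \<notin> E" if "y u' \<noteq> 0" "y v' \<noteq> 0" "u' \<in> V" "v' \<in> V" for u' v'
          proof
            assume "(u', v') \<in> E"
            moreover have "x u' \<noteq> 0" "x v' \<noteq> 0"
              using y_x that ym by metis+
            ultimately have "(u', v') = (a, b)"
              using E_unique[OF _ ab(1) clique] ab by auto
            then show False
              using that t ym V by (auto simp: y_def split: if_splits)
          qed
          ultimately show ?thesis
            using old[OF *(2,4)] uv * by blast
        qed
      qed
      moreover have "flat y = x"
      proof
        fix v
        show "flat y v = x v"
        proof (cases "v \<in> V")
          case True
          have "flat y v = y v + y (m (a, b)) * inc (a, b) v"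
            by (rule flat_single[OF True ab(1)]) (simp add: y_m)
          then show ?thesis
            using ym[OF True] by (auto simp: y_m ab inc_def y_def)
        next
          case False
          then have "x v = 0"
            by (rule clique_cone_zero[OF x])
          with False show ?thesis
            by (simp add: flat_def)
        qed
      qed
      ultimately show ?thesis by (metis imageI)
    qed
  qed
  then have "bij_betw (lincomb V \<phi> \<circ> flat) ?C' (coord_space D)"
    using bij by (rule bij_betw_trans)
  \<comment> \<open>Exchanging the sums collects, at each midpoint, the vectors of the two ends of
    its edge, which add up to its own vector by \<open>\<psi>_new\<close>.\<close>
  moreover have "lincomb V \<phi> \<circ> flat = lincomb (V \<union> m ` E) \<psi>"
  proof (intro ext)
    fix x :: "'a \<Rightarrow> real" and i
    have "(lincomb V \<phi> \<circ> flat) x i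
        = (\<Sum>v\<in>V. x v * \<phi> v i) + (\<Sum>v\<in>V. \<Sum>e\<in>E. x (m e) * inc e v * \<phi> v i)"
      by (simp add: lincomb_def flat_def distrib_right sum.distrib sum_distrib_right)
    also have "(\<Sum>v\<in>V. \<Sum>e\<in>E. x (m e) * inc e v * \<phi> v i)
        = (\<Sum>e\<in>E. x (m e) * (\<Sum>v\<in>V. inc e v * \<phi> v i))"
      by (subst sum.swap) (simp add: sum_distrib_left mult.assoc)
    also have "\<dots> = (\<Sum>e\<in>E. x (m e) * \<psi> (m e) i)"
    proof (intro sum.cong refl)
      fix e assume "e \<in> E"
      obtain a b where e: "e = (a, b)" by (cases e)
      with E \<open>e \<in> E\<close> have V: "a \<in> V" "b \<in> V" "a \<noteq> b" by auto
      have "(\<Sum>v\<in>V. inc e v * \<phi> v i) = (\<Sum>v\<in>{a, b}. inc e v * \<phi> v i)"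
        using V finV by (intro sum.mono_neutral_right) (auto simp: inc_def e)
      also have "\<dots> = \<psi> (m e) i"
        using V \<psi>_new \<open>e \<in> E\<close> by (simp add: inc_def e)
      finally show "x (m e) * (\<Sum>v\<in>V. inc e v * \<phi> v i) = x (m e) * \<psi> (m e) i"
        by simp
    qed
    also have "\<dots> = (\<Sum>v\<in>m ` E. x v * \<psi> v i)"
      using m(1) by (simp add: sum.reindex)
    finally show "(lincomb V \<phi> \<circ> flat) x i = lincomb (V \<union> m ` E) \<psi> x i"
      using m(2) finV finE \<psi>_old by (simp add: lincomb_def sum.union_disjoint inf_commute)
  qed
  ultimately show ?thesis
    using finV finE by (simp add: complete_fan_def)
qed

section \<open>The joins of cycles and their subdivisions\<close>

definition cyclic_adj :: "nat \<Rightarrow> nat \<Rightarrow> nat \<Rightarrow> bool" where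
  "cyclic_adj k i j \<longleftrightarrow> Suc i = j \<or> Suc j = i \<or> i = 0 \<and> Suc j = k \<or> j = 0 \<and> Suc i = k"

text \<open>
  Vertices are pairs of a tag and a position: the tags \<open>0\<close> and \<open>1\<close> are those of the cycles, each
  larger tag is that of the two points of a suspension and is also the coordinate they span. Two
  cycles take up the coordinates \<open>0..3\<close>, so their suspensions use the tags from \<open>4\<close> on, and the
  tag \<open>2\<close> is free for the midpoints of the subdivided edges.
\<close>

definition join_adj :: "nat \<Rightarrow> nat \<times> nat \<Rightarrow> nat \<times> nat \<Rightarrow> bool" where
  "join_adj k u v \<longleftrightarrow> fst u \<noteq> fst v \<or> fst u < 2 \<and> cyclic_adj k (snd u) (snd v)"

definition unit_vec :: "nat \<Rightarrow> nat \<Rightarrow> real" where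
  "unit_vec p i = (if i = p then 1 else 0)"

text \<open>
  Position \<open>k\<close> of a cycle arises by subdividing the edge between the positions \<open>k - 1\<close> and \<open>0\<close>, so its
  vector is the sum of their vectors.
\<close>

definition cycle_vec :: "nat \<Rightarrow> nat \<Rightarrow> nat \<Rightarrow> nat \<Rightarrow> real" where
  "cycle_vec p q j i =
     (if j = 0 then unit_vec q i
      else if j = 1 then - unit_vec p i
      else if j = 2 then - unit_vec q i
      else unit_vec p i + (real j - 3) * unit_vec q i)"

definition join_vec :: "nat \<times> nat \<Rightarrow> nat \<Rightarrow> real" where
  "join_vec v i =
     (if fst v < 2 then cycle_vec (2 * fst v) (2 * fst v + 1) (snd v) i
      else if snd v = 0 then unit_vec (fst v) i else - unit_vec (fst v) i)"

lemma join_adj_sym: "join_adj k u v \<Longrightarrow> join_adj k v u"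
  unfolding join_adj_def cyclic_adj_def by metis

text \<open>Passing from \<open>k\<close> to \<open>Suc k\<close> subdivides the closing edge
  between \<open>k - 1\<close> and \<open>0\<close> by the position \<open>k\<close>. The last claim
  says that no triangle lies over this edge, which leaves the new position with just two
  neighbours.\<close>

lemma cyclic_adj_Suc:
  assumes "4 \<le> k" "i < k"
  shows "j < k \<Longrightarrow> cyclic_adj (Suc k) i j \<longleftrightarrow>
      cyclic_adj k i j \<and> \<not> (i = k - 1 \<and> j = 0) \<and> \<not> (i = 0 \<and> j = k - 1)"
    and "cyclic_adj (Suc k) k i \<longleftrightarrow> i = k - 1 \<or> i = 0"
    and "\<not> (cyclic_adj k (k - 1) i \<and> cyclic_adj k 0 i)"
  using assms by (cases k; auto simp: cyclic_adj_def)+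

text \<open>The four-cycle is the join of its two pairs of opposite positions, and longer cycles
  arise from it by repeated edge subdivision.\<close>

lemma complete_fan_cycle:
  assumes "t < 2" "4 \<le> k"
  shows "complete_fan {2 * t, 2 * t + 1} ({t} \<times> {..<k}) (join_adj k) join_vec"
  using assms(2)
proof (induction k rule: nat_induct_at_least)
  case base
  have "complete_fan {2 * t + 1} {(t, 0), (t, 2)} (join_adj 4) join_vec"
    using assms(1) by (intro complete_fan_two_points)
      (auto simp: join_adj_def cyclic_adj_def join_vec_def cycle_vec_def unit_vec_def)
  \<comment> \<open>The coefficient \<open>real j - 3\<close> vanishes at position \<open>3\<close>,
    so its vector is opposite to that of position \<open>1\<close>.\<close>
  moreover have "complete_fan {2 * t} {(t, 3), (t, 1)} (join_adj 4) join_vec"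
    using assms(1) by (intro complete_fan_two_points)
      (auto simp: join_adj_def cyclic_adj_def join_vec_def cycle_vec_def unit_vec_def)
  ultimately have "complete_fan ({2 * t + 1} \<union> {2 * t}) ({(t, 0), (t, 2)} \<union> {(t, 3), (t, 1)})
      (join_adj 4) join_vec"
    using assms(1) by (intro complete_fan_join) (auto simp: join_adj_def cyclic_adj_def)
  moreover have "{(t, 0), (t, 2)} \<union> {(t, 3), (t, 1)} = {t} \<times> {..<4::nat}"
    by auto
  ultimately show ?case
    by (simp add: insert_commute)
next
  case (Suc k)
  have "complete_fan {2 * t, 2 * t + 1}
      ({t} \<times> {..<k} \<union> (\<lambda>_. (t, k)) ` {((t, k - 1), (t, 0::nat))}) (join_adj (Suc k)) join_vec"
  proof (rule complete_fan_subdivide[OF Suc.IH join_adj_sym,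
        where E = "{((t, k - 1), (t, 0))}" and m = "\<lambda>_. (t, k)"])
    show "join_adj (Suc k) u v \<longleftrightarrow>
        join_adj k u v \<and> (u, v) \<notin> {((t, k - 1), (t, 0))} \<and> (v, u) \<notin> {((t, k - 1), (t, 0))}"
      if "u \<in> {t} \<times> {..<k}" "v \<in> {t} \<times> {..<k}" for u v
      using that assms(1) cyclic_adj_Suc(1)[OF Suc.hyps, of "snd u" "snd v"]
      by (cases u; cases v) (auto simp: join_adj_def)
    show "join_adj (Suc k) (t, k) v \<longleftrightarrow> v = a \<or> v = b \<or> join_adj k a v \<and> join_adj k b v"
      if "(a, b) \<in> {((t, k - 1), (t, 0))}" "v \<in> {t} \<times> {..<k}" for a b v
      using that assms(1) cyclic_adj_Suc(2,3)[OF Suc.hyps, of "snd v"]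
      by (cases v) (auto simp: join_adj_def)
    show "join_adj (Suc k) v (t, k) \<longleftrightarrow> join_adj (Suc k) (t, k) v" for v
      using join_adj_sym by blast
    show "join_vec (t, k) i = join_vec a i + join_vec b i"
      if "(a, b) \<in> {((t, k - 1), (t, 0))}" for a b i
      using that assms(1) Suc.hyps
      by (auto simp: join_vec_def cycle_vec_def of_nat_diff algebra_simps)
    show "a \<in> {t} \<times> {..<k} \<and> b \<in> {t} \<times> {..<k} \<and> a \<noteq> b \<and> join_adj k a b"
      if "(a, b) \<in> {((t, k - 1), (t, 0))}" for a b
      using that assms(1) Suc.hyps by (auto simp: join_adj_def cyclic_adj_def)
  qed (auto simp: join_vec_def)
  moreover have "{t} \<times> {..<k} \<union> (\<lambda>_. (t, k)) ` {((t, k - 1), (t, 0::nat))} = {t} \<times> {..<Suc k}"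
    by auto
  ultimately show ?case by simp
qed

text \<open>Each tag contributes a join with two opposite points on a fresh axis. In the
  applications \<open>r\<close> counts the coordinates already taken: \<open>4\<close> after two
  cycles, \<open>2\<close> after a single one.\<close>

lemma complete_fan_suspensions:
  assumes "complete_fan D V (join_adj k) join_vec" "2 \<le> r" "r \<le> d"
    "D \<inter> {r..<d} = {}" "V \<inter> {r..<d} \<times> UNIV = {}"
  shows "complete_fan (D \<union> {r..<d}) (V \<union> {r..<d} \<times> {0, 1}) (join_adj k) join_vec"
  using assms(3-)
proof (induction d rule: dec_induct)
  case base
  with assms(1) show ?case by simp
next
  case (step n)
  have two: "complete_fan {n} {(n, 0), (n, 1)} (join_adj k) join_vec"
    using step.hyps assms(2) by (intro complete_fan_two_points)
      (auto simp: join_adj_def join_vec_def unit_vec_def)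
  have IH: "complete_fan (D \<union> {r..<n}) (V \<union> {r..<n} \<times> {0, 1}) (join_adj k) join_vec"
    using step.prems by (intro step.IH) auto
  have fst_V: "fst u \<noteq> n" if "u \<in> V" for u
    using that step.prems(2) step.hyps(1) by (cases u) (auto simp: disjoint_iff)
  have "complete_fan (D \<union> {r..<n} \<union> {n}) (V \<union> {r..<n} \<times> {0, 1} \<union> {(n, 0), (n, 1)})
      (join_adj k) join_vec"
  proof (rule complete_fan_join[OF IH two])
    show "join_adj k u v \<and> join_adj k v u"
      if "u \<in> V \<union> {r..<n} \<times> {0, 1}" "v \<in> {(n, 0), (n, 1)}" for u v
      using that fst_V[of u] by (auto simp: join_adj_def)
    show "(V \<union> {r..<n} \<times> {0, 1}) \<inter> {(n, 0), (n, 1)} = {}"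
      using fst_V by fastforce
    show "(D \<union> {r..<n}) \<inter> {n} = {}"
      using step.prems(1) step.hyps(1) by (auto simp: disjoint_iff)
  qed
  moreover have "D \<union> {r..<n} \<union> {n} = D \<union> {r..<Suc n}"
    "V \<union> {r..<n} \<times> {0, 1} \<union> {(n, 0), (n, 1)} = V \<union> {r..<Suc n} \<times> {0, 1}"
    using step.hyps by auto
  ultimately show ?case by simp
qed

lemma complete_fan_two_cycles:
  assumes "4 \<le> d" "4 \<le> k"
  shows "complete_fan {..<d} ({0, 1} \<times> {..<k} \<union> {4..<d} \<times> {0, 1}) (join_adj k) join_vec"
proof -
  have "complete_fan {0, 1} ({0} \<times> {..<k}) (join_adj k) join_vec"
    "complete_fan {2, 3} ({1} \<times> {..<k}) (join_adj k) join_vec"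
    using complete_fan_cycle[of 0 k] complete_fan_cycle[of 1 k] assms(2) by simp_all
  then have "complete_fan ({0, 1} \<union> {2, 3}) ({0} \<times> {..<k} \<union> {1} \<times> {..<k}) (join_adj k) join_vec"
    by (rule complete_fan_join) (auto simp: join_adj_def)
  also have "{0} \<times> {..<k} \<union> {1} \<times> {..<k} = {0, 1::nat} \<times> {..<k}"
    by auto
  finally have "complete_fan ({0, 1} \<union> {2, 3} \<union> {4..<d}) ({0, 1} \<times> {..<k} \<union> {4..<d} \<times> {0, 1})
      (join_adj k) join_vec"
    by (rule complete_fan_suspensions) (use assms in auto)
  moreover have "{0, 1} \<union> {2, 3} \<union> {4..<d} = {..<d}"
    using assms(1) by auto
  ultimately show ?thesis by simp
qed

section \<open>Subdivision of the odd edges\<close>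

definition odd_edges :: "nat \<Rightarrow> ((nat \<times> nat) \<times> (nat \<times> nat)) set" where
  "odd_edges p = (\<lambda>(i, j). ((0, 2 * i + 1), (1, 2 * j + 1))) ` ({..<p} \<times> {..<p})"

text \<open>Both positions are coded in one number, so that midpoints are again pairs of a tag and a
  position.\<close>

definition edge_point :: "(nat \<times> nat) \<times> (nat \<times> nat) \<Rightarrow> nat \<times> nat" where
  "edge_point e = (2, prod_encode (snd (fst e), snd (snd e)))"

text \<open>The old neighbours of a midpoint \<open>w\<close>: the two ends of its edge and their
  common neighbours, as an edge subdivision demands.\<close>

definition touches :: "nat \<Rightarrow> nat \<times> nat \<Rightarrow> nat \<times> nat \<Rightarrow> bool" where
  "touches k w v \<longleftrightarrow> (let (i, j) = prod_decode (snd w) in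
     v = (0, i) \<or> v = (1, j) \<or> join_adj k (0, i) v \<and> join_adj k (1, j) v)"

definition subdivided_adj :: "nat \<Rightarrow> nat \<times> nat \<Rightarrow> nat \<times> nat \<Rightarrow> bool" where
  "subdivided_adj p u v \<longleftrightarrow>
     (if fst u = 2 then fst v \<noteq> 2 \<and> touches (2 * p) u v
      else if fst v = 2 then touches (2 * p) v u
      else join_adj (2 * p) u v \<and> (u, v) \<notin> odd_edges p \<and> (v, u) \<notin> odd_edges p)"

definition subdivided_vec :: "nat \<times> nat \<Rightarrow> nat \<Rightarrow> real" where
  "subdivided_vec v =
     (if fst v = 2 then
        (let (i, j) = prod_decode (snd v) in (\<lambda>l. join_vec (0, i) l + join_vec (1, j) l))
      else join_vec v)"

lemma inj_on_edge_point: "inj_on edge_point (odd_edges p)"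
  by (auto simp: inj_on_def edge_point_def odd_edges_def)

lemma card_odd_edges: "card (odd_edges p) = p ^ 2"
  unfolding odd_edges_def
  by (subst card_image) (auto simp: inj_on_def power2_eq_square)

text \<open>Two odd positions are never neighbours: consecutive positions differ in parity, and the
  closing edge contains position \<open>0\<close>. So a clique has at most one odd position for each
  tag, which determines its odd edge.\<close>

lemma odd_edges_unique:
  assumes "(a, b) \<in> odd_edges p" "(c, d) \<in> odd_edges p" "F \<in> clique_complex V (join_adj (2 * p))"
    "{a, b, c, d} \<subseteq> F"
  shows "(a, b) = (c, d)"
proof -
  have odd: "i = j" if "(t, 2 * i + 1) \<in> F" "(t, 2 * j + 1) \<in> F" for t i j
  proof (rule ccontr)
    assume "i \<noteq> j"
    with that assms(3) have "join_adj (2 * p) (t, 2 * i + 1) (t, 2 * j + 1)"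
      by (auto simp: clique_complex_def)
    then show False
      by (auto simp: join_adj_def cyclic_adj_def) presburger+
  qed
  from assms odd show ?thesis
    by (auto simp: odd_edges_def)
qed

lemma complete_fan_subdivided:
  assumes "4 \<le> d" "2 \<le> p"
  shows "complete_fan {..<d}
    ({0, 1} \<times> {..<2 * p} \<union> {4..<d} \<times> {0, 1} \<union> edge_point ` odd_edges p) (subdivided_adj p) subdivided_vec"
proof (rule complete_fan_subdivide[OF complete_fan_two_cycles join_adj_sym _ odd_edges_unique inj_on_edge_point])
  show "a \<in> {0, 1} \<times> {..<2 * p} \<union> {4..<d} \<times> {0, 1} \<and> b \<in> {0, 1} \<times> {..<2 * p} \<union> {4..<d} \<times> {0, 1}
      \<and> a \<noteq> b \<and> join_adj (2 * p) a b" if "(a, b) \<in> odd_edges p" for a b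
    using that by (auto simp: odd_edges_def join_adj_def)
  show "4 \<le> d" "4 \<le> 2 * p"
    using assms by auto
  show "edge_point ` odd_edges p \<inter> ({0, 1} \<times> {..<2 * p} \<union> {4..<d} \<times> {0, 1}) = {}"
    by (auto simp: edge_point_def)
  fix u v :: "nat \<times> nat"
  assume v: "v \<in> {0, 1} \<times> {..<2 * p} \<union> {4..<d} \<times> {0, 1}"
  then have fst_v: "fst v \<noteq> 2"
    by auto
  then show "subdivided_vec v = join_vec v"
    by (simp add: subdivided_vec_def)
  show "subdivided_adj p u v \<longleftrightarrow> join_adj (2 * p) u v \<and> (u, v) \<notin> odd_edges p \<and> (v, u) \<notin> odd_edges p"
    if "u \<in> {0, 1} \<times> {..<2 * p} \<union> {4..<d} \<times> {0, 1}"
  proof -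
    from that have "fst u \<noteq> 2" by auto
    with fst_v show ?thesis by (simp add: subdivided_adj_def)
  qed
  fix a b assume ab: "(a, b) \<in> odd_edges p"
  then obtain i j where ij: "a = (0, i)" "b = (1, j)"
    by (auto simp: odd_edges_def)
  show "subdivided_adj p (edge_point (a, b)) v \<longleftrightarrow> v = a \<or> v = b \<or> join_adj (2 * p) a v \<and> join_adj (2 * p) b v"
    "subdivided_adj p v (edge_point (a, b)) \<longleftrightarrow> subdivided_adj p (edge_point (a, b)) v"
    using fst_v by (simp_all add: subdivided_adj_def touches_def edge_point_def ij)
next
  show "\<not> subdivided_adj p (edge_point e) (edge_point e')" for e e'
    by (simp add: subdivided_adj_def edge_point_def)
  show "subdivided_vec (edge_point (a, b)) l = join_vec a l + join_vec b l"
    if "(a, b) \<in> odd_edges p" for a b l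
    using that by (auto simp: odd_edges_def subdivided_vec_def edge_point_def)
qed

section \<open>Independent sets in the subdivided spheres\<close>

text \<open>Serves to pass from a fan on pairs to a sphere on natural numbers, with pairs coded by
  \<open>prod_encode\<close>, while keeping track of the vertex count and of an independent
  set.\<close>

lemma flag_sphere_from_fan:
  fixes V :: "(nat \<times> nat) set"
  assumes fan: "complete_fan {..<d} V adj \<phi>" and "0 < d"
    and S: "S \<subseteq> V" "\<forall>u\<in>S. \<forall>v\<in>S. u \<noteq> v \<longrightarrow> \<not> adj u v"
  obtains K :: "nat set set" where "flag_sphere (d - 1) K" "f0 K = card V"
    "card S \<le> independence_number (graph_of K)" "independence_number (graph_of K) \<le> f0 K"
proof
  let ?g = prod_decode
  let ?K = "clique_complex (?g -` V) (\<lambda>u v. adj (?g u) (?g v))"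
  have "{..<d} = {..d - 1}"
    using \<open>0 < d\<close> by auto
  then have fan': "complete_fan {..d - 1} (?g -` V) (\<lambda>u v. adj (?g u) (?g v)) (\<lambda>v. \<phi> (?g v))"
    using complete_fan_reindex[OF fan bij_prod_decode] by simp
  then show "flag_sphere (d - 1) ?K"
    by (rule flag_sphere_clique_complex)
  have fin: "finite (?g -` V)"
    using fan' by (simp add: complete_fan_def)
  have card: "card (?g -` W) = card W" for W
    by (rule card_vimage_inj) (auto simp: inj_prod_decode surj_prod_decode)
  then show f0: "f0 ?K = card V"
    by (simp add: f0_clique_complex)
  show "independence_number (graph_of ?K) \<le> f0 ?K"
    using independence_number_le_card[OF fin] by (simp add: f0_clique_complex)
  have "card (?g -` S) \<le> independence_number (graph_of ?K)"
    by (rule card_le_independence_number[OF fin])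
      (use S in \<open>auto dest: injD[OF inj_prod_decode]\<close>)
  with card show "card S \<le> independence_number (graph_of ?K)"
    by simp
qed

text \<open>The \<open>p ^ 2\<close> midpoints are independent, and the
  \<open>4 * p + 2 * (d - 4)\<close> other vertices number at most
  \<open>(d + 4) * p\<close>.\<close>

lemma flag_sphere_large_independent:
  assumes "4 \<le> d" "2 \<le> p"
  obtains K :: "nat set set" where "flag_sphere (d - 1) K" "p ^ 2 \<le> f0 K"
    "f0 K \<le> independence_number (graph_of K) + (d + 4) * p"
    "independence_number (graph_of K) \<le> f0 K"
proof -
  let ?B = "{0, 1} \<times> {..<2 * p} \<union> {4..<d} \<times> {0, 1} :: (nat \<times> nat) set"
  let ?M = "edge_point ` odd_edges p"
  have indep: "\<forall>u\<in>?M. \<forall>v\<in>?M. u \<noteq> v \<longrightarrow> \<not> subdivided_adj p u v"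
    by (auto simp: subdivided_adj_def edge_point_def)
  have "0 < d"
    using assms(1) by simp
  then obtain K :: "nat set set" where K: "flag_sphere (d - 1) K" "f0 K = card (?B \<union> ?M)"
    "card ?M \<le> independence_number (graph_of K)" "independence_number (graph_of K) \<le> f0 K"
    using flag_sphere_from_fan[OF complete_fan_subdivided[OF assms] _ Un_upper2 indep] by blast
  have M: "card ?M = p ^ 2"
    by (simp add: card_image inj_on_edge_point card_odd_edges)
  have "finite (?B \<union> ?M)"
    by (auto simp: odd_edges_def)
  then have "p ^ 2 \<le> f0 K"
    unfolding K(2) M[symmetric] by (rule card_mono) simp
  moreover have "f0 K \<le> independence_number (graph_of K) + (d + 4) * p"
  proof -
    have "card ?B \<le> card ({0, 1::nat} \<times> {..<2 * p}) + card ({4..<d} \<times> {0, 1::nat})"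
      by (rule card_Un_le)
    also have "\<dots> = 4 * p + (d - 4) * 2"
      by (simp only: card_cartesian_product) simp
    \<comment> \<open>Here \<open>2 \<le> p\<close> absorbs the suspension points into a term linear
      in \<open>p\<close>.\<close>
    also have "(d - 4) * 2 \<le> d * p"
      using assms(2) by (intro mult_mono) auto
    finally have "card ?B \<le> (d + 4) * p"
      by (simp add: algebra_simps)
    moreover have "card (?B \<union> ?M) \<le> card ?B + card ?M"
      by (rule card_Un_le)
    ultimately show ?thesis
      using K(2,3) by linarith
  qed
  ultimately show thesis
    using that K by blast
qed

theorem theorem1p2:
  fixes d :: nat
  assumes "d \<ge> 2"
  shows "\<exists>(C :: real) (K :: nat \<Rightarrow> nat set set).
     C > 0 \<and>
     (\<forall>n. flag_sphere (d - 1) (K n)) \<and>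
     filterlim (\<lambda>n. f0 (K n)) at_top sequentially \<and>
     (\<forall>\<^sub>F n in sequentially.
        real (independence_number (graph_of (K n))) \<ge>
          real (f0 (K n)) - C * real (f0 (K n)) / ln (real (f0 (K n))) ^ (d div 2 - 1)) \<and>
     (d \<ge> 4 \<longrightarrow>
        (\<lambda>n. real (independence_number (graph_of (K n))) / real (f0 (K n))) \<longlonglongrightarrow> 1)"
proof (cases "4 \<le> d")
  \<comment> \<open>For \<open>d\<close> equal to 2 or 3 the exponent \<open>d div 2 - 1\<close> is
    0, so with \<open>C = 1\<close> the bound says only that the independence number is nonnegative.
    Any flag spheres with a growing number of vertices serve; here they are cycles suspended
    \<open>d - 2\<close> times.\<close>
  case False
  have "\<exists>K :: nat set set. flag_sphere (d - 1) K \<and> n + 4 \<le> f0 K" for n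
  proof -
    let ?V = "{0} \<times> {..<n + 4} \<union> {2..<d} \<times> {0, 1} :: (nat \<times> nat) set"
    have "complete_fan {0, 1} ({0} \<times> {..<n + 4}) (join_adj (n + 4)) join_vec"
      using complete_fan_cycle[of 0 "n + 4"] by simp
    then have "complete_fan ({0, 1} \<union> {2..<d}) ?V (join_adj (n + 4)) join_vec"
      by (rule complete_fan_suspensions) (use assms in auto)
    moreover have "{0, 1} \<union> {2..<d} = {..<d}"
      using assms by auto
    ultimately have "complete_fan {..<d} ?V (join_adj (n + 4)) join_vec"
      by simp
    moreover have "0 < d"
      using assms by simp
    ultimately obtain K :: "nat set set" where "flag_sphere (d - 1) K" "f0 K = card ?V"
      using flag_sphere_from_fan[OF _ _ empty_subsetI] by blast
    moreover have "card ({0::nat} \<times> {..<n + 4}) \<le> card ?V"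
      by (rule card_mono) auto
    ultimately show ?thesis
      by (auto simp: card_cartesian_product)
  qed
  then obtain K :: "nat \<Rightarrow> nat set set" where K: "\<And>n. flag_sphere (d - 1) (K n)" "\<And>n. n + 4 \<le> f0 (K n)"
    by metis
  have "filterlim (\<lambda>n. f0 (K n)) at_top sequentially"
    by (rule filterlim_at_top_mono[OF filterlim_ident])
      (use K(2) add_leD1 in \<open>blast intro: always_eventually\<close>)
  moreover have "d div 2 - 1 = 0"
    using False by simp
  ultimately show ?thesis
    using K(1) False by (intro exI[of _ 1] exI[of _ K]) simp
next
  case True
  define \<alpha> where "\<alpha> K = independence_number (graph_of K)" for K :: "nat set set"
  \<comment> \<open>The factor of \<open>p\<close> in the bound on the number of vertices that are
    not midpoints.\<close>
  define C where "C = real (d + 4)"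
  have "\<exists>K :: nat set set. flag_sphere (d - 1) K \<and> (n + 2) ^ 2 \<le> f0 K \<and>
      f0 K \<le> \<alpha> K + (d + 4) * (n + 2) \<and> \<alpha> K \<le> f0 K" for n
    using flag_sphere_large_independent[OF True, of "n + 2"] unfolding \<alpha>_def by (metis le_add2)
  then obtain K :: "nat \<Rightarrow> nat set set" where K: "\<And>n. flag_sphere (d - 1) (K n)"
    and sq: "\<And>n. (n + 2) ^ 2 \<le> f0 (K n)"
    and lower: "\<And>n. f0 (K n) \<le> \<alpha> (K n) + (d + 4) * (n + 2)" and upper: "\<And>n. \<alpha> (K n) \<le> f0 (K n)"
    by metis
  let ?f = "\<lambda>n. real (f0 (K n))"
  have "n \<le> f0 (K n)" for n
    using sq[of n] by (auto simp: power2_eq_square)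
  then have lim: "filterlim (\<lambda>n. f0 (K n)) at_top sequentially"
    by (intro filterlim_at_top_mono[OF filterlim_ident]) auto
  then have lim': "filterlim ?f at_top sequentially"
    by (rule filterlim_compose[OF filterlim_real_sequentially])
  have fpos: "?f n > 0" for n
    using sq[of n] by (auto intro: Nat.gr0I)
  \<comment> \<open>Since \<open>(n + 2) ^ 2\<close> is at most the number of vertices, the deficit,
    linear in \<open>n + 2\<close>, is at most \<open>C\<close> times the square root of that
    number.\<close>
  have gap: "?f n - C * sqrt (?f n) \<le> real (\<alpha> (K n))" for n
  proof -
    have "real (n + 2) ^ 2 \<le> ?f n"
      using sq[of n] by (metis of_nat_le_iff of_nat_power)
    then have "C * real (n + 2) \<le> C * sqrt (?f n)"
      by (intro mult_left_mono real_le_rsqrt) (auto simp: C_def)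
    moreover have "?f n \<le> real (\<alpha> (K n)) + C * real (n + 2)"
      using lower[of n] unfolding C_def by (metis of_nat_add of_nat_le_iff of_nat_mult)
    ultimately show ?thesis by simp
  qed
  have "\<forall>\<^sub>F n in sequentially. ln (?f n) ^ (d div 2 - 1) \<le> sqrt (?f n)"
    by (rule eventually_compose_filterlim[OF ln_power_le_sqrt lim'])
  moreover have "\<forall>\<^sub>F n in sequentially. 1 < ?f n"
    using lim' unfolding filterlim_at_top_dense by blast
  ultimately have "\<forall>\<^sub>F n in sequentially. real (\<alpha> (K n)) \<ge> ?f n - C * ?f n / ln (?f n) ^ (d div 2 - 1)"
  proof eventually_elim
    case (elim n)
    let ?L = "ln (?f n) ^ (d div 2 - 1)"
    have "?L > 0"
      using elim(2) by simp
    \<comment> \<open>Multiplying the bound on the power of the logarithm by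
      \<open>sqrt (?f n)\<close> shows that the square root deficit is within the allowed
      one.\<close>
    moreover have "sqrt (?f n) * ?L \<le> sqrt (?f n) * sqrt (?f n)"
      using elim(1) by (intro mult_left_mono) auto
    ultimately have "sqrt (?f n) \<le> ?f n / ?L"
      by (simp add: pos_le_divide_eq)
    then have "C * sqrt (?f n) \<le> C * (?f n / ?L)"
      by (intro mult_left_mono) (auto simp: C_def)
    with gap[of n] show ?case by simp
  qed
  moreover have "(\<lambda>n. real (\<alpha> (K n)) / ?f n) \<longlonglongrightarrow> 1"
  \<comment> \<open>By \<open>gap\<close> the ratio lies between \<open>1 - C / sqrt (?f n)\<close>
    and 1.\<close>
  proof (rule tendsto_sandwich)
    show "\<forall>\<^sub>F n in sequentially. 1 - C * inverse (sqrt (?f n)) \<le> real (\<alpha> (K n)) / ?f n"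
    proof (intro always_eventually allI)
      fix n
      have "(1 - C * inverse (sqrt (?f n))) * ?f n = ?f n - C * sqrt (?f n)"
        using fpos[of n] by (simp add: field_simps)
      with gap[of n] fpos[of n] show "1 - C * inverse (sqrt (?f n)) \<le> real (\<alpha> (K n)) / ?f n"
        by (simp add: pos_le_divide_eq)
    qed
    show "\<forall>\<^sub>F n in sequentially. real (\<alpha> (K n)) / ?f n \<le> 1"
      using upper fpos by (simp add: divide_le_eq)
    have "(\<lambda>n. inverse (sqrt (?f n))) \<longlonglongrightarrow> 0"
      by (intro tendsto_inverse_0_at_top filterlim_compose[OF sqrt_at_top lim'])
    from tendsto_diff[OF tendsto_const[of 1] tendsto_mult_left[OF this, of C]]
    show "(\<lambda>n. 1 - C * inverse (sqrt (?f n))) \<longlonglongrightarrow> 1"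
      by simp
  qed simp
  moreover have "C > 0"
    by (simp add: C_def)
  ultimately show ?thesis
    using K lim unfolding \<alpha>_def by blast
qed

end
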